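(* Let $\Omega$ be a set and let $G = \mathrm{Sym}(\Omega)$. Let $g \in G$ be a permutation which has an infinite number of cycles of length $k$, for some $k>1$, where $k$ may be infinite. Then $\mathrm{Cent}_G(g)$ is not join-coherent.
   Context: For a permutation group $H$ on a set $\Omega$ and $h\in H$, $\pi(h)$ denotes the partition of $\Omega$ into the orbits of $h$, and $\pi(H)=\{\pi(h)\mid h\in H\}$. Partitions are ordered by refinement, and $\vee$ denotes the supremum (join) of two partitions. $H$ is join-coherent if $\pi(H)$ is closed under $\vee$. $\mathrm{Cent}_G(g)$ is the centralizer of $g$ in $G$, acting naturally on $\Omega$. *)

theory Defs
  imports
    "HOL-Algebra.Group_Action"
    "HOL-Algebra.Elementary_Groups"
    "HOL-Library.Disjoint_Sets"
    "HOL-Library.Extended_Nat"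
begin

text \<open>
  The symmetric group on \<open>\<Omega>\<close> is \<^const>\<open>BijGroup\<close> \<open>\<Omega>\<close>, whose elements are the bijections of \<open>\<Omega>\<close>
  (extended by \<^const>\<open>undefined\<close> outside \<open>\<Omega>\<close>). The orbits of a single permutation \<open>h\<close> are those of
  the cyclic group it generates, so negative powers are included and an infinite cycle is a
  single orbit.
\<close>

definition orbit_partition :: "'a set \<Rightarrow> ('a \<Rightarrow> 'a) \<Rightarrow> 'a set set" where
  "orbit_partition \<Omega> h = orbits (subgroup_generated (BijGroup \<Omega>) {h}) \<Omega> (\<lambda>f. f)"

definition orbit_partitions :: "'a set \<Rightarrow> ('a \<Rightarrow> 'a) set \<Rightarrow> 'a set set set" where
  "orbit_partitions \<Omega> H = orbit_partition \<Omega> ` H"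

text \<open>
  \<^term>\<open>refines \<Omega> P Q\<close> means that \<open>P\<close> is finer than \<open>Q\<close>, that is, \<open>P \<le> Q\<close>. The supremum is
  taken among all partitions of \<open>\<Omega>\<close>, not just among orbit partitions.
\<close>

definition is_partition_join ::
    "'a set \<Rightarrow> 'a set set \<Rightarrow> 'a set set \<Rightarrow> 'a set set \<Rightarrow> bool" where
  "is_partition_join \<Omega> P Q R \<longleftrightarrow>
     refines \<Omega> P R \<and> refines \<Omega> Q R \<and>
     (\<forall>S. refines \<Omega> P S \<and> refines \<Omega> Q S \<longrightarrow> refines \<Omega> R S)"

definition join_coherent :: "'a set \<Rightarrow> ('a \<Rightarrow> 'a) set \<Rightarrow> bool" where
  "join_coherent \<Omega> H \<longleftrightarrow>
     (\<forall>P\<in>orbit_partitions \<Omega> H. \<forall>Q\<in>orbit_partitions \<Omega> H.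
        \<exists>R\<in>orbit_partitions \<Omega> H. is_partition_join \<Omega> P Q R)"

definition centralizer :: "('g, 'b) monoid_scheme \<Rightarrow> 'g \<Rightarrow> 'g set" where
  "centralizer G g = {h \<in> carrier G. h \<otimes>\<^bsub>G\<^esub> g = g \<otimes>\<^bsub>G\<^esub> h}"

text \<open>Cycles are identified with their supports, the orbits; fixed points are cycles of length 1.\<close>

definition cycle_length :: "'a set \<Rightarrow> enat" where
  "cycle_length C = (if finite C then enat (card C) else \<infinity>)"

text \<open>
  The following facts confirm that the orbits of a permutation form a partition and that any two
  partitions have exactly one join, so that the existential quantifier in \<open>join_coherent\<close> says
  that the join lies in \<open>orbit_partitions \<Omega> H\<close>.
\<close>

lemma orbit_partition_eq_int_powers:
  assumes "h \<in> carrier (BijGroup \<Omega>)"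
  shows "orbit_partition \<Omega> h =
    {{(h [^]\<^bsub>BijGroup \<Omega>\<^esub> (i::int)) x | i. True} | x. x \<in> \<Omega>}"
proof -
  interpret group "BijGroup \<Omega>" by (rule group_BijGroup)
  have carrier: "carrier (subgroup_generated (BijGroup \<Omega>) {h}) =
      {h [^]\<^bsub>BijGroup \<Omega>\<^esub> (i::int) | i. i \<in> UNIV}"
    using assms generate_pow[OF assms] by (simp add: carrier_subgroup_generated)
  have orbit: "orbit (subgroup_generated (BijGroup \<Omega>) {h}) (\<lambda>f. f) x =
      {(h [^]\<^bsub>BijGroup \<Omega>\<^esub> (i::int)) x | i. True}" for x
    unfolding orbit_def carrier by blast
  show ?thesis
    unfolding orbit_partition_def orbits_def orbit ..
qed

lemma partition_on_orbit_partition: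
  assumes "h \<in> carrier (BijGroup \<Omega>)"
  shows "partition_on \<Omega> (orbit_partition \<Omega> h)"
proof -
  interpret group "BijGroup \<Omega>" by (rule group_BijGroup)
  let ?K = "subgroup_generated (BijGroup \<Omega>) {h}"
  have sub: "carrier ?K \<subseteq> carrier (BijGroup \<Omega>)"
    by (rule carrier_subgroup_generated_subset)
  have "group_hom ?K (BijGroup \<Omega>) (\<lambda>f. f)"
    using sub by (auto simp: group_hom_def group_hom_axioms_def hom_def is_group)
  then interpret group_action ?K \<Omega> "\<lambda>f. f"
    by (simp add: group_action_def)
  show ?thesis
    unfolding partition_on_def disjoint_def
  proof (intro conjI ballI impI)
    show "\<Union> (orbit_partition \<Omega> h) = \<Omega>"
      unfolding orbit_partition_def using orbits_coverture .
  next
    fix A B assume "A \<in> orbit_partition \<Omega> h" "B \<in> orbit_partition \<Omega> h" "A \<noteq> B"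
    then show "A \<inter> B = {}"
      unfolding orbit_partition_def using disjoint_union by blast
  next
    show "{} \<notin> orbit_partition \<Omega> h"
      unfolding orbit_partition_def orbits_def using orbit_refl by auto
  qed
qed

lemma ex1_partition_join:
  assumes P: "partition_on \<Omega> P" and Q: "partition_on \<Omega> Q"
  shows "\<exists>!R. is_partition_join \<Omega> P Q R"
proof (rule ex_ex1I)
  fix R R' assume "is_partition_join \<Omega> P Q R" "is_partition_join \<Omega> P Q R'"
  then show "R = R'"
    unfolding is_partition_join_def using refines_asym[of \<Omega> R R'] by simp
next
  let ?C = "{S. refines \<Omega> P S \<and> refines \<Omega> Q S}"
  define r where "r = {(x, y). x \<in> \<Omega> \<and> y \<in> \<Omega> \<and> (\<forall>S\<in>?C. \<exists>X\<in>S. x \<in> X \<and> y \<in> X)}"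
  have part: "partition_on \<Omega> S" if "S \<in> ?C" for S
    using that by (simp add: refines_def)
  have block_eq: "X = Y" if "S \<in> ?C" "X \<in> S" "Y \<in> S" "z \<in> X" "z \<in> Y" for S X Y z
    using part[OF that(1)] that(2-) unfolding partition_on_def disjoint_def by blast
  have "equiv \<Omega> r"
  proof (rule equivI)
    show "r \<subseteq> \<Omega> \<times> \<Omega>" by (auto simp: r_def)
    show "refl_on \<Omega> r"
    proof (rule refl_onI)
      fix x assume x: "x \<in> \<Omega>"
      have "\<exists>X\<in>S. x \<in> X" if "S \<in> ?C" for S
        using part[OF that] x by (auto simp: partition_on_def)
      then show "(x, x) \<in> r" using x by (simp add: r_def)
    qed
    show "sym r" by (auto simp: r_def sym_def)
    show "trans r"
    proof (rule transI)
      fix x y z assume xy: "(x, y) \<in> r" and yz: "(y, z) \<in> r"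
      have "\<exists>X\<in>S. x \<in> X \<and> z \<in> X" if S: "S \<in> ?C" for S
      proof -
        obtain X Y where "X \<in> S" "x \<in> X" "y \<in> X" "Y \<in> S" "y \<in> Y" "z \<in> Y"
          using xy yz S unfolding r_def by blast
        with block_eq[OF S] show ?thesis by blast
      qed
      then show "(x, z) \<in> r" using xy yz by (simp add: r_def)
    qed
  qed
  have R: "partition_on \<Omega> (\<Omega> // r)"
    using \<open>equiv \<Omega> r\<close> by (rule partition_on_quotient)
  have upper: "refines \<Omega> T (\<Omega> // r)"
    if T: "partition_on \<Omega> T" and le: "\<And>S. S \<in> ?C \<Longrightarrow> refines \<Omega> T S" for T
    unfolding refines_def
  proof (intro conjI ballI T R)
    fix X assume X: "X \<in> T"
    then obtain x where x: "x \<in> X" using T unfolding partition_on_def by (metis ex_in_conv)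
    have sub: "X \<subseteq> \<Omega>" using T X by (auto simp: partition_on_def)
    have "(x, y) \<in> r" if "y \<in> X" for y
    proof -
      have "\<exists>Y\<in>S. x \<in> Y \<and> y \<in> Y" if "S \<in> ?C" for S
        using le[OF that] X x \<open>y \<in> X\<close> unfolding refines_def by blast
      then show ?thesis using x that sub by (auto simp: r_def)
    qed
    then have "X \<subseteq> r `` {x}" by auto
    moreover have "r `` {x} \<in> \<Omega> // r" using x sub by (auto intro: quotientI)
    ultimately show "\<exists>Y\<in>\<Omega> // r. X \<subseteq> Y" by blast
  qed
  have lower: "refines \<Omega> (\<Omega> // r) S" if S: "S \<in> ?C" for S
    unfolding refines_def
  proof (intro conjI ballI R part[OF S])
    fix X assume "X \<in> \<Omega> // r"
    then obtain x where x: "x \<in> \<Omega>" "X = r `` {x}" by (auto elim: quotientE)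
    obtain Y where Y: "Y \<in> S" "x \<in> Y"
      using part[OF S] x by (auto simp: partition_on_def)
    have "X \<subseteq> Y"
    proof
      fix y assume "y \<in> X"
      then obtain Z where "Z \<in> S" "x \<in> Z" "y \<in> Z" using x S unfolding r_def by blast
      with block_eq[OF S] Y show "y \<in> Y" by blast
    qed
    then show "\<exists>Y\<in>S. X \<subseteq> Y" using Y by blast
  qed
  have "is_partition_join \<Omega> P Q (\<Omega> // r)"
    unfolding is_partition_join_def using upper[OF P] upper[OF Q] lower by blast
  then show "\<exists>R. is_partition_join \<Omega> P Q R" ..
qed

end

theory Submission
  imports Defs "HOL-Library.Countable"
begin

text \<open>
  Choose cycles \<open>C\<^sub>i\<close> (\<open>i \<in> \<int>\<close>) of \<open>g\<close> of length \<open>k\<close>, with representatives \<open>x\<^sub>i\<close>. Both the shift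
  \<open>h\<close> sending \<open>g\<^sup>n x\<^sub>i\<close> to \<open>g\<^sup>n x\<^sub>i\<^sub>+\<^sub>1\<close> and the permutation \<open>q\<close> acting as \<open>g\<close> on \<open>C\<^sub>0\<close> and trivially
  elsewhere centralize \<open>g\<close>. In the join of \<open>\<pi>(h)\<close> and \<open>\<pi>(q)\<close> all the \<open>x\<^sub>i\<close> and \<open>g x\<^sub>0\<close> lie in one
  block. If this block is an orbit of some \<open>c\<close> that centralizes \<open>g\<close>, then \<open>g x\<^sub>0 = c\<^sup>m x\<^sub>0\<close> with \<open>m \<noteq> 0\<close>,
  so \<open>g\<close> acts as \<open>c\<^sup>m\<close> on the block, which is therefore made up of at most \<open>\<bar>m\<bar>\<close> cycles of \<open>g\<close>: a
  contradiction.
\<close>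

section \<open>Integer powers of a permutation and their action on points\<close>

abbreviation perm_pow :: "'a set \<Rightarrow> ('a \<Rightarrow> 'a) \<Rightarrow> int \<Rightarrow> 'a \<Rightarrow> 'a" where
  "perm_pow \<Omega> h i \<equiv> h [^]\<^bsub>BijGroup \<Omega>\<^esub> i"

lemma carrier_BijGroup: "carrier (BijGroup \<Omega>) = Bij \<Omega>"
  by (simp add: BijGroup_def)

lemma perm_pow_closed:
  assumes "h \<in> carrier (BijGroup \<Omega>)" "x \<in> \<Omega>"
  shows "perm_pow \<Omega> h i x \<in> \<Omega>"
proof -
  interpret group "BijGroup \<Omega>" by (rule group_BijGroup)
  have "h [^]\<^bsub>BijGroup \<Omega>\<^esub> i \<in> Bij \<Omega>"
    using int_pow_closed[OF assms(1), of i] unfolding carrier_BijGroup .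
  then show ?thesis
    by (rule funcset_mem[OF Bij_imp_funcset assms(2)])
qed

lemma mult_BijGroup_apply:
  assumes "f \<in> carrier (BijGroup \<Omega>)" "h \<in> carrier (BijGroup \<Omega>)" "x \<in> \<Omega>"
  shows "(f \<otimes>\<^bsub>BijGroup \<Omega>\<^esub> h) x = f (h x)"
  using assms by (simp add: BijGroup_def compose_def)

lemma perm_pow_add:
  assumes "h \<in> carrier (BijGroup \<Omega>)" "x \<in> \<Omega>"
  shows "perm_pow \<Omega> h (i + j) x = perm_pow \<Omega> h i (perm_pow \<Omega> h j x)"
proof -
  interpret group "BijGroup \<Omega>" by (rule group_BijGroup)
  show ?thesis
    using assms by (simp add: int_pow_mult mult_BijGroup_apply)
qed

lemma one_BijGroup_apply: "x \<in> \<Omega> \<Longrightarrow> \<one>\<^bsub>BijGroup \<Omega>\<^esub> x = x"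
  by (simp add: BijGroup_def)

lemma perm_pow_0: "x \<in> \<Omega> \<Longrightarrow> perm_pow \<Omega> h 0 x = x"
  by (simp only: int_pow_0 one_BijGroup_apply)

lemma perm_pow_1: "h \<in> carrier (BijGroup \<Omega>) \<Longrightarrow> perm_pow \<Omega> h 1 = h"
  by (rule group.int_pow_1[OF group_BijGroup])

lemma perm_pow_uminus_cancel:
  assumes "h \<in> carrier (BijGroup \<Omega>)" "x \<in> \<Omega>"
  shows "perm_pow \<Omega> h (- i) (perm_pow \<Omega> h i x) = x"
proof -
  have "perm_pow \<Omega> h (- i) (perm_pow \<Omega> h i x) = perm_pow \<Omega> h (- i + i) x"
    by (rule perm_pow_add[OF assms, symmetric])
  also have "\<dots> = x" using perm_pow_0[OF assms(2)] by (simp only: left_minus)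
  finally show ?thesis .
qed

lemma perm_pow_eq_iff:
  assumes "h \<in> carrier (BijGroup \<Omega>)" "x \<in> \<Omega>" "y \<in> \<Omega>"
  shows "perm_pow \<Omega> h i x = perm_pow \<Omega> h j y \<longleftrightarrow> perm_pow \<Omega> h (i - j) x = y"
proof
  assume "perm_pow \<Omega> h i x = perm_pow \<Omega> h j y"
  then have "perm_pow \<Omega> h (- j) (perm_pow \<Omega> h i x) = y"
    by (simp add: perm_pow_uminus_cancel assms)
  then show "perm_pow \<Omega> h (i - j) x = y"
    using perm_pow_add[OF assms(1,2), of "- j" i] by simp
next
  assume "perm_pow \<Omega> h (i - j) x = y"
  then show "perm_pow \<Omega> h i x = perm_pow \<Omega> h j y"
    using perm_pow_add[OF assms(1,2), of j "i - j"] by simp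
qed

text \<open>The map \<open>f\<close> is a bare function, so that the lemma serves both for
  \<open>g\<close> against powers of \<open>c\<close> and for powers of \<open>c\<close> against
  powers of \<open>g\<close>. The induction runs in both directions from 0; in the downward step one
  factor \<open>h\<close> is cancelled.\<close>

lemma commute_perm_pow:
  assumes h: "h \<in> carrier (BijGroup \<Omega>)"
    and f: "\<And>y. y \<in> \<Omega> \<Longrightarrow> f y \<in> \<Omega>" "\<And>y. y \<in> \<Omega> \<Longrightarrow> f (h y) = h (f y)"
    and x: "x \<in> \<Omega>"
  shows "f (perm_pow \<Omega> h i x) = perm_pow \<Omega> h i (f x)"
proof (induction i rule: int_induct[where k = 0])
  case base
  then show ?case using f x by (simp add: one_BijGroup_apply)
next
  case (step1 i)
  have "f (perm_pow \<Omega> h (1 + i) x) = h (f (perm_pow \<Omega> h i x))"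
    using perm_pow_add[OF h x, of 1 i] perm_pow_closed[OF h x]
    by (simp add: perm_pow_1[OF h] f)
  also have "\<dots> = perm_pow \<Omega> h (1 + i) (f x)"
    using perm_pow_add[OF h f(1)[OF x], of 1 i] step1 by (simp add: perm_pow_1[OF h])
  finally show ?case by (simp add: add.commute)
next
  case (step2 i)
  have "h (f (perm_pow \<Omega> h (i - 1) x)) = f (perm_pow \<Omega> h i x)"
    using perm_pow_add[OF h x, of 1 "i - 1"] perm_pow_closed[OF h x]
    by (simp add: perm_pow_1[OF h] f)
  with step2 have "perm_pow \<Omega> h 1 (f (perm_pow \<Omega> h (i - 1) x)) = perm_pow \<Omega> h i (f x)"
    by (simp add: perm_pow_1[OF h])
  then show ?case
    using perm_pow_eq_iff[OF h f(1)[OF x] f(1)[OF perm_pow_closed[OF h x]], of i 1 "i - 1"]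
    by simp
qed

section \<open>Subgroups of the integers and the length of a cycle\<close>

text \<open>The generator is the least positive member, or 0 if there is none, and division with
  remainder does the rest. It will be applied to the exponents whose power fixes a given
  point.\<close>

lemma additive_int_subgroup_dvd:
  fixes S :: "int set"
  assumes "0 \<in> S" and diff: "\<And>i j. i \<in> S \<Longrightarrow> j \<in> S \<Longrightarrow> i - j \<in> S"
  shows "\<exists>d::nat. \<forall>i. i \<in> S \<longleftrightarrow> int d dvd i"
proof (cases "\<exists>d>0. int d \<in> S")
  case False
  have "i = 0" if "i \<in> S" for i
  proof (rule ccontr)
    assume "i \<noteq> 0"
    moreover have "- i \<in> S" using diff[OF \<open>0 \<in> S\<close> that] by simp
    ultimately have "int (nat \<bar>i\<bar>) \<in> S" "nat \<bar>i\<bar> > 0" using that by (auto simp: abs_if)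
    with False show False by blast
  qed
  then show ?thesis using \<open>0 \<in> S\<close> by (intro exI[of _ 0]) auto
next
  case True
  define d where "d = (LEAST d. d > 0 \<and> int d \<in> S)"
  have d: "d > 0" "int d \<in> S"
    using LeastI_ex[OF True] by (auto simp: d_def)
  have add: "i + j \<in> S" if "i \<in> S" "j \<in> S" for i j
    using diff[OF that(1) diff[OF \<open>0 \<in> S\<close> that(2)]] by simp
  have mult: "int d * q \<in> S" for q
  proof (induction q rule: int_induct[where k = 0])
    case (step1 q)
    then show ?case using add[OF _ d(2)] by (simp add: distrib_left)
  next
    case (step2 q)
    then show ?case using diff[OF _ d(2)] by (simp add: right_diff_distrib)
  qed (simp add: \<open>0 \<in> S\<close>)
  have "int d dvd i" if "i \<in> S" for i
  proof -
    have "i mod int d \<in> S"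
      using diff[OF that mult[of "i div int d"]] by (simp add: minus_mult_div_eq_mod)
    moreover have bounds: "i mod int d \<ge> 0" "i mod int d < int d" using d by auto
    moreover have "nat (i mod int d) < d" using bounds by linarith
    then have "\<not> (nat (i mod int d) > 0 \<and> int (nat (i mod int d)) \<in> S)"
      unfolding d_def by (rule not_less_Least)
    ultimately have "i mod int d = 0" by simp
    then show ?thesis by (rule mod_eq_0_iff_dvd[THEN iffD1])
  qed
  moreover have "i \<in> S" if "int d dvd i" for i
    using mult that by (metis dvdE)
  ultimately show ?thesis by blast
qed

text \<open>An infinite cycle has \<^const>\<open>card\<close> zero, and zero divides only zero.\<close>

lemma perm_pow_fixes_iff_card_dvd:
  assumes h: "h \<in> carrier (BijGroup \<Omega>)" and x: "x \<in> \<Omega>"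
  shows "perm_pow \<Omega> h i x = x \<longleftrightarrow> int (card (range (\<lambda>j. perm_pow \<Omega> h j x))) dvd i"
proof -
  let ?p = "\<lambda>j. perm_pow \<Omega> h j x"
  let ?S = "{i. ?p i = x}"
  have "i - j \<in> ?S" if "i \<in> ?S" "j \<in> ?S" for i j
    using that perm_pow_eq_iff[OF h x x, of i j] by simp
  then obtain d :: nat where d: "\<And>i. ?p i = x \<longleftrightarrow> int d dvd i"
    using additive_int_subgroup_dvd[of ?S] perm_pow_0[OF x] by auto
  have eq: "?p i = ?p j \<longleftrightarrow> int d dvd i - j" for i j
    using perm_pow_eq_iff[OF h x x, of i j] d by simp
  have "card (range ?p) = d"
  proof (cases "d = 0")
    case True
    \<comment> \<open>Only the exponent 0 fixes \<open>x\<close>, so all powers give different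
      points; the infinite orbit has \<open>card\<close> 0, which agrees with
      \<open>d\<close>.\<close>
    then have "inj ?p" using eq by (auto intro!: injI)
    then have "infinite (range ?p)" by (simp add: finite_image_iff)
    then show ?thesis using True by simp
  next
    case False
    have "range ?p = ?p ` {0..<int d}"
    proof (intro equalityI subsetI)
      fix y assume "y \<in> range ?p"
      then obtain i where "y = ?p i" by blast
      also have "\<dots> = ?p (i mod int d)" unfolding eq by (simp add: minus_mod_eq_mult_div)
      finally show "y \<in> ?p ` {0..<int d}" using False by auto
    qed auto
    moreover have "inj_on ?p {0..<int d}"
    proof (rule inj_onI)
      fix i j assume ij: "i \<in> {0..<int d}" "j \<in> {0..<int d}" "?p i = ?p j"
      from ij(3) have "i mod int d = j mod int d" by (simp only: eq mod_eq_dvd_iff)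
      then show "i = j" using ij by simp
    qed
    ultimately show ?thesis by (simp add: card_image)
  qed
  with d show ?thesis by simp
qed

section \<open>Construction of elements of the centralizer\<close>

text \<open>
  The elements constructed here make up the wreath product of the group of powers of \<open>g\<close> by the
  symmetric group on the chosen cycles, which all have the same length.
\<close>

lemma centralizer_permutes_cycles:
  fixes x :: "'i \<Rightarrow> 'a" and s :: "'i \<Rightarrow> int"
  assumes g: "g \<in> carrier (BijGroup \<Omega>)"
    and x: "\<And>i. x i \<in> \<Omega>"
    and disj: "\<And>i j m n. perm_pow \<Omega> g m (x i) = perm_pow \<Omega> g n (x j) \<Longrightarrow> i = j"
    and len: "\<And>i j n. perm_pow \<Omega> g n (x i) = x i \<Longrightarrow> perm_pow \<Omega> g n (x j) = x j"
    and \<sigma>: "bij \<sigma>"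
  shows "\<exists>h\<in>centralizer (BijGroup \<Omega>) g.
    \<forall>i n. h (perm_pow \<Omega> g n (x i)) = perm_pow \<Omega> g (n + s i) (x (\<sigma> i))"
proof -
  let ?p = "perm_pow \<Omega> g"
  define Y where "Y = {?p n (x i) | n i. True}"
  \<comment> \<open>\<open>SOME\<close> picks one way of writing \<open>y\<close> as a power of
    \<open>g\<close> at a representative: the index is unique by \<open>disj\<close>, the exponent
    only up to periods of that cycle. The permutation and the shift are arguments so that the
    inverse is another instance of \<open>F\<close>.\<close>
  define F where "F = (\<lambda>\<sigma> s y. if y \<in> Y
      then (case SOME (i, n). y = ?p n (x i) of (i, n) \<Rightarrow> ?p (n + s i) (x (\<sigma> i)))
      else if y \<in> \<Omega> then y else undefined)"
  have Y: "Y \<subseteq> \<Omega>" using perm_pow_closed[OF g x] by (auto simp: Y_def)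
  have F1: "F \<sigma> s (?p n (x i)) = ?p (n + s i) (x (\<sigma> i))" for \<sigma> :: "'i \<Rightarrow> 'i" and s n i
  proof -
    define t where "t = (SOME (j, m). ?p n (x i) = ?p m (x j))"
    have "case t of (j, m) \<Rightarrow> ?p n (x i) = ?p m (x j)"
      unfolding t_def by (rule someI[of _ "(i, n)"]) simp
    then obtain m where t: "t = (i, m)" and m: "?p n (x i) = ?p m (x i)"
      using disj by (cases t) auto
    \<comment> \<open>The exponents \<open>m\<close> and \<open>n\<close> differ by a period of
      \<open>x i\<close>, which by \<open>len\<close> is also a period of the target cycle; the
      value thus does not depend on the choice.\<close>
    have "?p (m - n) (x (\<sigma> i)) = x (\<sigma> i)"
      using m[symmetric] perm_pow_eq_iff[OF g x x] len by blast
    then have "?p (m + s i - (n + s i)) (x (\<sigma> i)) = x (\<sigma> i)" by simp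
    then have "?p (m + s i) (x (\<sigma> i)) = ?p (n + s i) (x (\<sigma> i))"
      by (subst perm_pow_eq_iff[OF g x x])
    moreover have "?p n (x i) \<in> Y" by (auto simp: Y_def)
    ultimately show ?thesis
      using t unfolding F_def t_def by simp
  qed
  have F2: "F \<sigma> s y = y" if "y \<in> \<Omega>" "y \<notin> Y" for \<sigma> :: "'i \<Rightarrow> 'i" and s y
    using that by (simp add: F_def)
  have F_closed: "F \<sigma> s y \<in> \<Omega>" if "y \<in> \<Omega>" for \<sigma> :: "'i \<Rightarrow> 'i" and s y
  proof (cases "y \<in> Y")
    case True
    then show ?thesis using F1 perm_pow_closed[OF g x] by (auto simp: Y_def)
  next
    case False
    then show ?thesis using F2 that by simp
  qed
  define \<tau> where "\<tau> = inv_into UNIV \<sigma>"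
  \<comment> \<open>The inverse leads from index \<open>i\<close> back to \<open>\<tau> i\<close>
    and must undo the shift that was added there, hence \<open>s (\<tau> i)\<close>.\<close>
  let ?h = "F \<sigma> s" and ?h' = "F \<tau> (\<lambda>i. - s (\<tau> i))"
  have \<sigma>_inv: "\<sigma> (\<tau> i) = i" "\<tau> (\<sigma> i) = i" for i
    using \<sigma> by (auto simp: \<tau>_def bij_def surj_f_inv_f)
  have "bij_betw ?h \<Omega> \<Omega>"
  proof (rule bij_betw_byWitness[where f' = ?h'])
    show "\<forall>y\<in>\<Omega>. ?h' (?h y) = y"
    proof
      fix y assume "y \<in> \<Omega>"
      then show "?h' (?h y) = y"
        by (cases "y \<in> Y") (auto simp: Y_def F1 F2 \<sigma>_inv)
    qed
    show "\<forall>y\<in>\<Omega>. ?h (?h' y) = y"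
    proof
      fix y assume "y \<in> \<Omega>"
      then show "?h (?h' y) = y"
        by (cases "y \<in> Y") (auto simp: Y_def F1 F2 \<sigma>_inv)
    qed
  qed (use F_closed in auto)
  moreover have "?h \<in> extensional \<Omega>"
    using Y by (auto simp: F_def extensional_def)
  ultimately have h: "?h \<in> carrier (BijGroup \<Omega>)"
    by (simp add: BijGroup_def Bij_def)
  have gp: "g (?p n y) = ?p (n + 1) y" if "y \<in> \<Omega>" for n y
    using perm_pow_add[OF g that, of 1 n] by (simp add: perm_pow_1[OF g] add.commute)
  have "?h (g y) = g (?h y)" if y: "y \<in> \<Omega>" for y
  proof (cases "y \<in> Y")
    case True
    then obtain n i where "y = ?p n (x i)" by (auto simp: Y_def)
    then show ?thesis by (simp add: F1 gp x algebra_simps)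
  next
    case False
    \<comment> \<open>\<open>Y\<close> is a union of whole cycles of \<open>g\<close>, so no point
      outside is mapped into it.\<close>
    have "g y \<notin> Y"
    proof
      assume "g y \<in> Y"
      then obtain n i where "?p 1 y = ?p n (x i)" by (auto simp: Y_def perm_pow_1[OF g])
      then have "y = ?p (n - 1) (x i)" using perm_pow_eq_iff[OF g x y] by metis
      with False show False by (auto simp: Y_def)
    qed
    then show ?thesis
      using False y perm_pow_closed[OF g y, of 1] by (simp add: perm_pow_1[OF g] F2)
  qed
  then have "?h \<otimes>\<^bsub>BijGroup \<Omega>\<^esub> g = g \<otimes>\<^bsub>BijGroup \<Omega>\<^esub> ?h"
    using h g by (auto simp: BijGroup_def compose_def fun_eq_iff)
  then show ?thesis
    using h F1 by (intro bexI[of _ ?h]) (auto simp: centralizer_def)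
qed

section \<open>Cycles of \<open>g\<close> that meet an orbit of a centralizing permutation\<close>

text \<open>As \<open>c\<close> commutes with \<open>g\<close>, the relation
  \<open>g x = c^m x\<close> spreads to \<open>g^q x = c^(m*q) x\<close>. Hence points
  \<open>c^j x\<close> whose exponents are congruent modulo \<open>m\<close> lie on the same cycle
  of \<open>g\<close>, and the residues bound the number of cycles.\<close>

lemma finitely_many_cycles_in_centralizer_orbit:
  assumes g: "g \<in> carrier (BijGroup \<Omega>)" and c: "c \<in> centralizer (BijGroup \<Omega>) g"
    and x: "x \<in> \<Omega>" "g x \<noteq> x" "g x = perm_pow \<Omega> c m x"
  shows "finite {C \<in> orbit_partition \<Omega> g. C \<inter> range (\<lambda>j. perm_pow \<Omega> c j x) \<noteq> {}}"
proof -
  let ?p = "perm_pow \<Omega> g" and ?c = "perm_pow \<Omega> c"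
  have cG: "c \<in> carrier (BijGroup \<Omega>)" and cg: "c \<otimes>\<^bsub>BijGroup \<Omega>\<^esub> g = g \<otimes>\<^bsub>BijGroup \<Omega>\<^esub> c"
    using c by (auto simp: centralizer_def)
  note closed = perm_pow_closed[OF g] perm_pow_closed[OF cG]
  have comm1: "g (c y) = c (g y)" if "y \<in> \<Omega>" for y
    using mult_BijGroup_apply[OF g cG that] mult_BijGroup_apply[OF cG g that] by (simp add: cg)
  have g_closed: "g y \<in> \<Omega>" if "y \<in> \<Omega>" for y
    using closed(1)[OF that, of 1] by (simp add: perm_pow_1[OF g])
  have comm2: "g (?c j y) = ?c j (g y)" if "y \<in> \<Omega>" for j y
    by (rule commute_perm_pow[OF cG, where f = g]) (simp_all add: g_closed comm1 that)
  have comm3: "?c j (?p i y) = ?p i (?c j y)" if "y \<in> \<Omega>" for i j y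
    by (rule commute_perm_pow[OF g, where f = "?c j"]) (simp_all add: closed comm2 that)
  have pow: "?p q x = ?c (m * q) x" for q
  proof (induction q rule: int_induct[where k = 0])
    case base
    then show ?case by (simp add: one_BijGroup_apply x)
  next
    case (step1 q)
    have "?p (q + 1) x = ?p q (?c m x)"
      using perm_pow_add[OF g x(1), of q 1] by (simp add: perm_pow_1[OF g] x(3))
    also have "\<dots> = ?c (m * (q + 1)) x"
      using perm_pow_add[OF cG x(1), of m "m * q"] step1
      by (simp add: comm3[OF x(1), symmetric] algebra_simps)
    finally show ?case .
  next
    case (step2 q)
    \<comment> \<open>Moved past the power of \<open>g\<close>, the factor \<open>c^m\<close> acts
      on \<open>x\<close> as one more \<open>g\<close>; cancelling it afterwards gives the downward
      step.\<close>
    have "?c m (?p (q - 1) x) = ?p (q - 1) (?p 1 x)"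
      by (simp add: comm3 x perm_pow_1[OF g])
    also have "\<dots> = ?c (m * q) x"
      using perm_pow_add[OF g x(1), of "q - 1" 1] step2 by simp
    finally show ?case
      using perm_pow_eq_iff[OF cG, of x "?p (q - 1) x" "m * q" m] closed x(1)
      by (simp add: algebra_simps)
  qed
  \<comment> \<open>With \<open>m = 0\<close> the point \<open>x\<close> would be fixed by
    \<open>g\<close>. A nonzero \<open>m\<close> lets every exponent be reduced to a finite set of
    residues.\<close>
  have "m \<noteq> 0" using x perm_pow_0[of x \<Omega> c] by auto
  let ?O = "\<lambda>r. {?p i (?c r x) | i. True}"
  have "C \<in> ?O ` {0..<\<bar>m\<bar>}"
    if C: "C \<in> orbit_partition \<Omega> g" "?c j x \<in> C" for C j
  proof -
    define r where "r = j mod \<bar>m\<bar>"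
    have r: "r \<in> {0..<\<bar>m\<bar>}" using \<open>m \<noteq> 0\<close> by (simp add: r_def)
    have "\<exists>q. j = r + m * q"
    proof -
      have "\<bar>m\<bar> dvd j - r" by (simp add: r_def minus_mod_eq_mult_div)
      then have "m dvd j - r" by simp
      then obtain q where "j - r = m * q" by (elim dvdE)
      then have "j = r + m * q" by simp
      then show ?thesis ..
    qed
    then obtain q where "?c j x = ?c r (?p q x)"
      using perm_pow_add[OF cG x(1)] pow by metis
    then have j: "?c j x = ?p q (?c r x)" by (simp add: comm3 x)
    have "?c j x \<in> ?O r" using j by blast
    moreover have "?O r \<in> orbit_partition \<Omega> g"
      using closed(2)[OF x(1)] by (auto simp: orbit_partition_eq_int_powers[OF g])
    moreover have "disjoint (orbit_partition \<Omega> g)"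
      using partition_on_orbit_partition[OF g] by (simp add: partition_on_def)
    ultimately have "C = ?O r"
      using C disjointD[of "orbit_partition \<Omega> g" C "?O r"] by (metis IntI empty_iff)
    then show ?thesis using r by (rule image_eqI)
  qed
  then have "{C \<in> orbit_partition \<Omega> g. C \<inter> range (\<lambda>j. ?c j x) \<noteq> {}} \<subseteq> ?O ` {0..<\<bar>m\<bar>}"
    by blast
  then show ?thesis by (rule finite_subset) simp
qed

text \<open>The points \<open>y\<close> and \<open>h y\<close> share an orbit of \<open>h\<close>,
  which lies within one block of the coarser partition. The equivalence carries membership along the
  shift in both directions.\<close>

lemma refines_orbit_partition_closed:
  assumes h: "h \<in> carrier (BijGroup \<Omega>)" and R: "refines \<Omega> (orbit_partition \<Omega> h) R"
    and B: "B \<in> R" and y: "y \<in> \<Omega>"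
  shows "h y \<in> B \<longleftrightarrow> y \<in> B"
proof -
  let ?O = "{perm_pow \<Omega> h i y | i. True}"
  have "?O \<in> orbit_partition \<Omega> h"
    using y by (auto simp: orbit_partition_eq_int_powers[OF h])
  then obtain B' where B': "B' \<in> R" "?O \<subseteq> B'" using R by (auto simp: refines_def)
  have "y \<in> ?O" using perm_pow_0[OF y, of h] by (metis (mono_tags, lifting) mem_Collect_eq)
  moreover have "h y \<in> ?O"
    using perm_pow_1[OF h] by (metis (mono_tags, lifting) mem_Collect_eq)
  moreover have "disjoint R" using R by (simp add: refines_def partition_on_def)
  ultimately show ?thesis using B B' unfolding disjoint_def by blast
qed

section \<open>A shift of the cycles and a rotation of a single cycle\<close>

theorem proposition6p3:
  fixes \<Omega> :: "'a set" and g :: "'a \<Rightarrow> 'a" and k :: enat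
  assumes "g \<in> carrier (BijGroup \<Omega>)"
    and "k > 1"
    and "infinite {C \<in> orbit_partition \<Omega> g. cycle_length C = k}"
  shows "\<not> join_coherent \<Omega> (centralizer (BijGroup \<Omega>) g)"
proof
  assume coherent: "join_coherent \<Omega> (centralizer (BijGroup \<Omega>) g)"
  note g = assms(1)
  let ?p = "perm_pow \<Omega> g"
  obtain E :: "nat \<Rightarrow> 'a set" where E: "inj E"
      "range E \<subseteq> {C \<in> orbit_partition \<Omega> g. cycle_length C = k}"
    using infinite_countable_subset[OF assms(3)] by blast
  \<comment> \<open>The cycles are indexed by the integers so that adding 1 is a bijection of the
    index set.\<close>
  define D where "D i = E (to_nat i)" for i :: int
  have D: "inj D" "\<And>i. D i \<in> orbit_partition \<Omega> g" "\<And>i. cycle_length (D i) = k"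
    using E by (auto simp: D_def inj_def image_subset_iff dest: injD[OF inj_to_nat])
  have "\<exists>y\<in>\<Omega>. D i = range (\<lambda>j. ?p j y)" for i
    using D(2)[of i] unfolding orbit_partition_eq_int_powers[OF g] by (auto simp: full_SetCompr_eq)
  then obtain x where x: "\<And>i. x i \<in> \<Omega>" "\<And>i. D i = range (\<lambda>j. ?p j (x i))"
    by metis
  have xD: "?p n (x i) \<in> D i" for n i using x by auto
  have block_eq: "C = C'"
    if "C \<in> orbit_partition \<Omega> g" "C' \<in> orbit_partition \<Omega> g" "y \<in> C" "y \<in> C'" for C C' y
    using partition_on_orbit_partition[OF g] that unfolding partition_on_def disjoint_def by blast
  have disj: "i = j" if "?p m (x i) = ?p n (x j)" for i j m n
    using block_eq[OF D(2) D(2) xD[of m i], of j] that xD[of n j] D(1) by (simp add: inj_eq)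
  have card_eq: "card (D i) = card (D j)" for i j
    using D(3)[of i] D(3)[of j] by (auto simp: cycle_length_def split: if_splits)
  \<comment> \<open>The periods are determined by \<open>card\<close>, which is the same for all
    chosen cycles and equals 0 if they are infinite.\<close>
  have len: "?p n (x j) = x j" if "?p n (x i) = x i" for i j n
    using that card_eq[of i j] unfolding perm_pow_fixes_iff_card_dvd[OF g x(1)] x(2)[symmetric]
    by simp
  have moved: "g (x 0) \<noteq> x 0"
  proof
    assume "g (x 0) = x 0"
    then have "int (card (D 0)) dvd 1"
      using perm_pow_fixes_iff_card_dvd[OF g x(1), of 1 0] x(2) by (simp add: perm_pow_1[OF g])
    then have "card (D 0) = 1" by simp
    \<comment> \<open>A \<open>card\<close> of 1 excludes an infinite cycle, so
      \<open>cycle_length\<close> takes its finite value.\<close>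
    then have "k = 1" using D(3)[of 0] card_ge_0_finite[of "D 0"]
      by (simp add: cycle_length_def one_enat_def)
    with assms(2) show False by simp
  qed
  have succ: "bij (\<lambda>i::int. i + 1)" by (rule bij_betw_byWitness[where f' = "\<lambda>i. i - 1"]) auto
  have "\<exists>h\<in>centralizer (BijGroup \<Omega>) g. \<forall>i n. h (?p n (x i)) = ?p (n + 0) (x (i + 1))"
    by (intro centralizer_permutes_cycles[OF g, where x = x and s = "\<lambda>_. 0"])
      (fact x(1) disj len succ)+
  then obtain h where h: "h \<in> centralizer (BijGroup \<Omega>) g"
      "\<And>i n. h (?p n (x i)) = ?p (n + 0) (x (i + 1))"
    by blast
  \<comment> \<open>The indices stay fixed and the exponent is shifted at index 0 only: this is
    \<open>g\<close> on \<open>D 0\<close> and the identity on every other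
    \<open>D i\<close>.\<close>
  have "\<exists>q\<in>centralizer (BijGroup \<Omega>) g.
      \<forall>i n. q (?p n (x i)) = ?p (n + (if i = 0 then 1 else 0)) (x (id i))"
    by (intro centralizer_permutes_cycles[OF g, where x = x]) (fact x(1) disj len bij_id)+
  then obtain q where q: "q \<in> centralizer (BijGroup \<Omega>) g"
      "\<And>i n. q (?p n (x i)) = ?p (n + (if i = 0 then 1 else 0)) (x (id i))"
    by blast
  have hx: "h (x i) = x (i + 1)" for i
    using h(2)[of 0 i] by (simp add: one_BijGroup_apply x)
  have qx: "q (x 0) = g (x 0)"
    using q(2)[of 0 0] by (simp add: one_BijGroup_apply x perm_pow_1[OF g])
  obtain c where c: "c \<in> centralizer (BijGroup \<Omega>) g"
      "is_partition_join \<Omega> (orbit_partition \<Omega> h) (orbit_partition \<Omega> q) (orbit_partition \<Omega> c)"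
    using coherent h(1) q(1) unfolding join_coherent_def orbit_partitions_def by blast
  have carriers: "h \<in> carrier (BijGroup \<Omega>)" "q \<in> carrier (BijGroup \<Omega>)" "c \<in> carrier (BijGroup \<Omega>)"
    using h(1) q(1) c(1) by (auto simp: centralizer_def)
  let ?B = "range (\<lambda>j. perm_pow \<Omega> c j (x 0))"
  have B: "?B \<in> orbit_partition \<Omega> c"
    using x(1)[of 0] unfolding orbit_partition_eq_int_powers[OF carriers(3)]
    by (auto simp: full_SetCompr_eq)
  have x0: "x 0 \<in> ?B"
    using perm_pow_0[OF x(1)[of 0], of c] by (metis rangeI)
  have step: "x (i + 1) \<in> ?B \<longleftrightarrow> x i \<in> ?B" for i
    using refines_orbit_partition_closed[OF carriers(1) _ B x(1)] c(2) hx
    unfolding is_partition_join_def by metis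
  have xB: "x i \<in> ?B" for i
  proof (induction i rule: int_induct[where k = 0])
    case base
    then show ?case by (rule x0)
  next
    case (step1 i)
    then show ?case using step by blast
  next
    case (step2 i)
    then show ?case using step[of "i - 1"] by simp
  qed
  have "g (x 0) \<in> ?B"
    using refines_orbit_partition_closed[OF carriers(2) _ B x(1)] c(2) x0 qx
    unfolding is_partition_join_def by metis
  then obtain m where "g (x 0) = perm_pow \<Omega> c m (x 0)" by blast
  from finitely_many_cycles_in_centralizer_orbit[OF g c(1) x(1) moved this]
  have "finite {C \<in> orbit_partition \<Omega> g. C \<inter> ?B \<noteq> {}}" .
  \<comment> \<open>By \<open>xB\<close> the block meets every \<open>D i\<close>, and
    \<open>D\<close> is injective, against the finiteness just obtained.\<close>
  moreover have "range D \<subseteq> {C \<in> orbit_partition \<Omega> g. C \<inter> ?B \<noteq> {}}"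
  proof -
    have "x i \<in> D i" for i using xD[of 0 i] by (simp add: one_BijGroup_apply x)
    then show ?thesis using D(2) xB by blast
  qed
  ultimately have "finite (range D)" using finite_subset by blast
  then show False using D(1) by (simp add: finite_image_iff)
qed

end
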